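(* Let $\langle \mathcal{S},\mathcal{A},\mathcal{L},T^\pi,\mu\rangle$ be a qualitative possibilistic MDP. Suppose there exists an action $\overline{a}\in\mathcal{A}$ such that, for all $s,s'\in\mathcal{S}$, $\pi(s'\mid s,\overline{a})=1_{\mathcal{L}}$ if $s'=s$ and $\pi(s'\mid s,\overline{a})=0_{\mathcal{L}}$ otherwise. Then the $\pi$-MDP Value Iteration Algorithm (described in the context) terminates and returns a pair $(u^*,\delta)$ such that $u^*$ is the maximum of the optimistic infinite-horizon criterion, i.e. $u^*(s)=\max_{(\delta')\in\Delta}u(s,(\delta'))$ for every $s\in\mathcal{S}$, and $\delta$ is an optimal stationary policy (a single decision rule, not depending on the stage of the process).
   Context: A qualitative possibilistic MDP ($\pi$-MDP) is a tuple $\langle \mathcal{S},\mathcal{A},\mathcal{L},T^\pi,\mu\rangle$ where $\mathcal{S}$ (states) and $\mathcal{A}$ (actions) are finite nonempty sets; $\mathcal{L}$ is a finite totally ordered set with least element $0_{\mathcal{L}}$ and greatest element $1_{\mathcal{L}}$, $0_{\mathcal{L}}\neq 1_{\mathcal{L}}$; $T^\pi(s,a,s')=\pi(s'\mid s,a)\in\mathcal{L}$ with $\max_{s'\in\mathcal{S}}\pi(s'\mid s,a)=1_{\mathcal{L}}$ for all $s,a$; and $\mu:\mathcal{S}\to\mathcal{L}$ is a preference function. All min and max of elements of $\mathcal{L}$ are taken in $\mathcal{L}$. A decision rule is a function $\mathcal{S}\to\mathcal{A}$. $\Delta_p$ is the set of $p$-sized policies $(\delta)=(\delta_0,\dots,\delta_{p-1})$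 (sequences of decision rules), $\Delta=\bigcup_{i\geq 1}\Delta_i$, and $\#\delta$ is the size of a policy $(\delta)$. $\mathcal{T}_p=\mathcal{S}^p$ is the set of $p$-sized trajectories $\tau=(s_1,\dots,s_p)$. For an initial state $s_0$ and $(\delta)\in\Delta_p$, $\Pi(\tau\mid s_0,(\delta))=\min_{t=0}^{p-1}\pi(s_{t+1}\mid s_t,\delta_t(s_t))$ and $M(\tau)=\mu(s_p)$. The optimistic (infinite-horizon) criterion is, for $(\delta)\in\Delta$, $$u(s,(\delta))=\max_{\tau\in\mathcal{T}_{\#\delta}}\min\{\Pi(\tau\mid s,(\delta)),M(\tau)\}.$$ A stationary policy given by a decision rule $\delta$ is optimal if for every $s\in\mathcal{S}$ there is $p\ge 1$ such that the $p$-sized policy $(\delta,\dots,\delta)$ satisfies $u(s,(\delta,\dots,\delta))=\max_{(\delta')\in\Delta}u(s,(\delta'))$. $\pi$-MDP Value Iteration Algorithm. Initialization: for every $s\in\mathcal{S}$, $u^*(s)\leftarrow 0_{\mathcal{L}}$, $u^c(s)\leftarrow\mu(s)$, $\delta(s)\leftarrow\overline{a}$. While $u^*\neq u^c$ (as functions on $\mathcal{S}$) do: set $u^*\leftarrow u^c$; then for each $s\in\mathcal{S}$ set $u^c(s)\leftarrow\max_{a\in\mathcal{A}}\max_{s'\in\mathcal{S}}\min\{\pi(s'\mid s,a),u^*(s')\}$ and, if $u^c(s)>u^*(s)$, set $\delta(s)$ to an (arbitrary) element of $\operatorname{argmax}_{a\in\mathcal{A}}\max_{s'\in\mathcal{S}}\min\{\pi(s'\mid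 s,a),u^*(s')\}$. Return $u^*,\delta$. *)

theory Defs
  imports Main
begin

text \<open>
  States, actions and the qualitative scale are finite types; types are nonempty, so nonemptiness
  of the state and action sets is implicit. A transition function is \<open>T s a s' = \<pi>(s' | s, a)\<close>,
  and \<open>bot\<close> and \<open>top\<close> are the least and greatest element of the scale.
\<close>

definition pi_mdp ::
  "('s::finite \<Rightarrow> 'a::finite \<Rightarrow> 's \<Rightarrow> 'l::{finite,linorder,order_bot,order_top}) \<Rightarrow> bool" where
  "pi_mdp T \<longleftrightarrow> (bot :: 'l) \<noteq> top \<and> (\<forall>s a. (MAX s'. T s a s') = top)"

type_synonym ('s, 'a) policy = "('s \<Rightarrow> 'a) list"

definition policies_of_size :: "nat \<Rightarrow> ('s, 'a) policy set" where
  "policies_of_size p = {\<delta>s. length \<delta>s = p}"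

definition policies :: "('s, 'a) policy set" where
  "policies = (\<Union>p\<in>{1..}. policies_of_size p)"

definition trajectories :: "nat \<Rightarrow> 's list set" where
  "trajectories p = {\<tau>. length \<tau> = p}"

text \<open>
  A trajectory \<open>\<tau> = [s\<^sub>1, \<dots>, s\<^sub>p]\<close> does not contain the initial state \<open>s0\<close>, so the state at stage
  \<open>t\<close> is \<open>(s0 # \<tau>) ! t\<close> and its successor is \<open>\<tau> ! t\<close>. The two notions below are only meaningful
  for \<open>p \<ge> 1\<close>.
\<close>

definition trajectory_poss ::
  "('s \<Rightarrow> 'a \<Rightarrow> 's \<Rightarrow> 'l::linorder) \<Rightarrow> 's \<Rightarrow> ('s, 'a) policy \<Rightarrow> 's list \<Rightarrow> 'l" where
  "trajectory_poss T s0 \<delta>s \<tau> =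
     (MIN t\<in>{..<length \<delta>s}. T ((s0 # \<tau>) ! t) ((\<delta>s ! t) ((s0 # \<tau>) ! t)) (\<tau> ! t))"

definition trajectory_pref :: "('s \<Rightarrow> 'l) \<Rightarrow> 's list \<Rightarrow> 'l" where
  "trajectory_pref \<mu> \<tau> = \<mu> (last \<tau>)"

definition criterion ::
  "('s \<Rightarrow> 'a \<Rightarrow> 's \<Rightarrow> 'l::linorder) \<Rightarrow> ('s \<Rightarrow> 'l) \<Rightarrow> 's \<Rightarrow> ('s, 'a) policy \<Rightarrow> 'l" where
  "criterion T \<mu> s \<delta>s =
     (MAX \<tau>\<in>trajectories (length \<delta>s). min (trajectory_poss T s \<delta>s \<tau>) (trajectory_pref \<mu> \<tau>))"

text \<open>
  The set of policies is infinite, but the maximum is over a nonempty set of values of the scale,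
  which is finite whenever the scale is.
\<close>

definition max_criterion ::
  "('s \<Rightarrow> 'a \<Rightarrow> 's \<Rightarrow> 'l::linorder) \<Rightarrow> ('s \<Rightarrow> 'l) \<Rightarrow> 's \<Rightarrow> 'l" where
  "max_criterion T \<mu> s = (MAX \<delta>s\<in>policies. criterion T \<mu> s \<delta>s)"

definition optimal_stationary ::
  "('s \<Rightarrow> 'a \<Rightarrow> 's \<Rightarrow> 'l::linorder) \<Rightarrow> ('s \<Rightarrow> 'l) \<Rightarrow> ('s \<Rightarrow> 'a) \<Rightarrow> bool" where
  "optimal_stationary T \<mu> \<delta> \<longleftrightarrow>
     (\<forall>s. \<exists>p\<ge>1. criterion T \<mu> s (replicate p \<delta>) = max_criterion T \<mu> s)"

definition action_value ::
  "('s::finite \<Rightarrow> 'a \<Rightarrow> 's \<Rightarrow> 'l::linorder) \<Rightarrow> ('s \<Rightarrow> 'l) \<Rightarrow> 's \<Rightarrow> 'a \<Rightarrow> 'l" where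
  "action_value T u s a = (MAX s'. min (T s a s') (u s'))"

text \<open>
  A configuration of value iteration is a triple of the program variables \<open>(u\<^sup>*, u\<^sup>c, \<delta>)\<close>.
  One step is one pass of the loop; since it first assigns \<open>u\<^sup>c\<close> to \<open>u\<^sup>*\<close>, the old \<open>u\<^sup>c\<close> (here \<open>u\<close>)
  is the function used in the body. The step relation is nondeterministic because any maximizing
  action may be chosen, independently in each state and each pass.
\<close>

type_synonym ('s, 'a, 'l) vi_config = "('s \<Rightarrow> 'l) \<times> ('s \<Rightarrow> 'l) \<times> ('s \<Rightarrow> 'a)"

definition vi_init :: "('s \<Rightarrow> 'l::order_bot) \<Rightarrow> 'a \<Rightarrow> ('s, 'a, 'l) vi_config" where
  "vi_init \<mu> abar = ((\<lambda>_. bot), \<mu>, (\<lambda>_. abar))"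

inductive vi_step ::
  "('s::finite \<Rightarrow> 'a::finite \<Rightarrow> 's \<Rightarrow> 'l::linorder)
    \<Rightarrow> ('s, 'a, 'l) vi_config \<Rightarrow> ('s, 'a, 'l) vi_config \<Rightarrow> bool"
  for T where
  "vi_step T (v, u, \<delta>) (u, u', \<delta>')"
  if "v \<noteq> u"
    and "\<And>s. u' s = (MAX a. action_value T u s a)"
    and "\<And>s. u' s > u s \<Longrightarrow> is_arg_max (action_value T u s) (\<lambda>_. True) (\<delta>' s)"
    and "\<And>s. \<not> u' s > u s \<Longrightarrow> \<delta>' s = \<delta> s"

definition vi_reachable ::
  "('s::finite \<Rightarrow> 'a::finite \<Rightarrow> 's \<Rightarrow> 'l::{linorder,order_bot}) \<Rightarrow> ('s \<Rightarrow> 'l) \<Rightarrow> 'a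
    \<Rightarrow> ('s, 'a, 'l) vi_config \<Rightarrow> bool" where
  "vi_reachable T \<mu> abar = (vi_step T)\<^sup>*\<^sup>* (vi_init \<mu> abar)"

text \<open>
  Termination is meant for all possible choices of maximizing actions: there is no infinite
  execution, and an execution can only stop because the loop condition fails.
\<close>

definition vi_terminates ::
  "('s::finite \<Rightarrow> 'a::finite \<Rightarrow> 's \<Rightarrow> 'l::{linorder,order_bot}) \<Rightarrow> ('s \<Rightarrow> 'l) \<Rightarrow> 'a \<Rightarrow> bool" where
  "vi_terminates T \<mu> abar \<longleftrightarrow>
     (\<nexists>c. c 0 = vi_init \<mu> abar \<and> (\<forall>i. vi_step T (c i) (c (Suc i)))) \<and>
     (\<forall>v u \<delta>. vi_reachable T \<mu> abar (v, u, \<delta>) \<longrightarrow> v \<noteq> u \<longrightarrow> (\<exists>c'. vi_step T (v, u, \<delta>) c'))"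

definition vi_returns ::
  "('s::finite \<Rightarrow> 'a::finite \<Rightarrow> 's \<Rightarrow> 'l::{linorder,order_bot}) \<Rightarrow> ('s \<Rightarrow> 'l) \<Rightarrow> 'a
    \<Rightarrow> ('s \<Rightarrow> 'l) \<Rightarrow> ('s \<Rightarrow> 'a) \<Rightarrow> bool" where
  "vi_returns T \<mu> abar v \<delta> \<longleftrightarrow> (\<exists>u. vi_reachable T \<mu> abar (v, u, \<delta>) \<and> v = u)"

end

theory Submission
  imports Defs
begin

text \<open>
  The iterates increase because \<open>abar\<close> stays put with possibility \<open>top\<close>, so they become stationary,
  and a stationary iterate dominates the criterion of every policy. Conversely, an action stored in
  \<open>s\<close> leads, with possibility at least \<open>u s\<close>, to a state \<open>s'\<close> whose value was already at least
  \<open>u s\<close> before the update of \<open>s\<close>. Hence either \<open>u s' > u s\<close>, or \<open>u s' = u s\<close> and \<open>s'\<close> was last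
  updated before \<open>s\<close>. Following \<open>\<delta>\<close> therefore cannot cycle before it reaches a state where
  \<open>u s \<le> \<mu> s\<close>, and the trajectory obtained attains \<open>u s\<close>.
\<close>

text \<open>Level-cut form of the criterion: a max of mins is at least \<open>c\<close> as soon as
  one trajectory keeps every transition and the final preference at level \<open>c\<close>.
  Recursion on the policy makes this accessible to induction; the empty policy serves as base
  case.\<close>

fun attains ::
  "('s \<Rightarrow> 'a \<Rightarrow> 's \<Rightarrow> 'l::linorder) \<Rightarrow> ('s \<Rightarrow> 'l) \<Rightarrow> 'l \<Rightarrow> 's \<Rightarrow> ('s, 'a) policy \<Rightarrow> bool" where
  "attains T \<mu> c s [] \<longleftrightarrow> c \<le> \<mu> s"
| "attains T \<mu> c s (d # \<delta>s) \<longleftrightarrow> (\<exists>s'. c \<le> T s (d s) s' \<and> attains T \<mu> c s' \<delta>s)"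

lemma attains_antimono: "attains T \<mu> c s \<delta>s \<Longrightarrow> c' \<le> c \<Longrightarrow> attains T \<mu> c' s \<delta>s"
  by (induction \<delta>s arbitrary: s) (auto intro: order_trans)

lemma attains_iff_trajectory:
  "attains T \<mu> c s \<delta>s \<longleftrightarrow>
    (\<exists>\<tau>. length \<tau> = length \<delta>s \<and>
      (\<forall>t<length \<delta>s. c \<le> T ((s # \<tau>) ! t) ((\<delta>s ! t) ((s # \<tau>) ! t)) (\<tau> ! t)) \<and>
      c \<le> \<mu> (last (s # \<tau>)))"
proof (induction \<delta>s arbitrary: s)
  case (Cons d \<delta>s)
  let ?P = "\<lambda>s \<delta>s \<tau>. length \<tau> = length \<delta>s \<and>
      (\<forall>t<length \<delta>s. c \<le> T ((s # \<tau>) ! t) ((\<delta>s ! t) ((s # \<tau>) ! t)) (\<tau> ! t)) \<and>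
      c \<le> \<mu> (last (s # \<tau>))"
  \<comment> \<open>Index 0 is the transition from \<open>s\<close> to \<open>s'\<close>; the
    indices \<open>Suc t\<close> are the conditions on the rest, started in
    \<open>s'\<close>.\<close>
  have "?P s (d # \<delta>s) (s' # \<tau>) \<longleftrightarrow> c \<le> T s (d s) s' \<and> ?P s' \<delta>s \<tau>" for s' \<tau>
    by (simp only: length_Cons All_less_Suc2) auto
  moreover have "(\<exists>\<tau>. ?P s (d # \<delta>s) \<tau>) \<longleftrightarrow> (\<exists>s' \<tau>. ?P s (d # \<delta>s) (s' # \<tau>))"
    by (auto simp only: length_Cons length_Suc_conv)
  ultimately have "(\<exists>\<tau>. ?P s (d # \<delta>s) \<tau>) \<longleftrightarrow>
      (\<exists>s'. c \<le> T s (d s) s' \<and> (\<exists>\<tau>. ?P s' \<delta>s \<tau>))"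
    by (simp only: ex_simps)
  then show ?case by (simp only: attains.simps Cons.IH)
qed auto

text \<open>Nonemptiness makes the minimum over stages range over a nonempty set and
  \<open>last (s # \<tau>)\<close> agree with \<open>last \<tau>\<close>.\<close>

lemma le_criterion_iff:
  fixes T :: "'s::finite \<Rightarrow> 'a \<Rightarrow> 's \<Rightarrow> 'l::linorder"
  assumes "\<delta>s \<noteq> []"
  shows "c \<le> criterion T \<mu> s \<delta>s \<longleftrightarrow> attains T \<mu> c s \<delta>s"
proof -
  have fin: "finite (trajectories n :: 's list set)" for n
    using finite_lists_length_eq[OF finite_UNIV, of n] by (simp add: trajectories_def)
  have ne: "trajectories n \<noteq> ({} :: 's list set)" for n
    by (auto simp: trajectories_def intro: exI[of _ "replicate n undefined"])
  have "c \<le> criterion T \<mu> s \<delta>s \<longleftrightarrow>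
    (\<exists>\<tau>\<in>trajectories (length \<delta>s). c \<le> trajectory_poss T s \<delta>s \<tau> \<and> c \<le> \<mu> (last \<tau>))"
    using fin ne by (simp add: criterion_def trajectory_pref_def Max_ge_iff)
  also have "\<dots> \<longleftrightarrow> attains T \<mu> c s \<delta>s"
    using assms
    by (auto simp: attains_iff_trajectory trajectories_def trajectory_poss_def lessThan_empty_iff
        intro!: ex_cong1)
  finally show ?thesis .
qed

text \<open>Backward induction: the level \<open>c\<close> passes from the final state back to
  \<open>s\<close>, one transition at a time.\<close>

lemma le_if_attains:
  assumes "\<And>s. \<mu> s \<le> u s"
    and "\<And>s a s'. min (T s a s') (u s') \<le> u s"
    and "attains T \<mu> c s \<delta>s"
  shows "c \<le> u s"
  using assms(3)
proof (induction \<delta>s arbitrary: s)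
  case Nil
  then show ?case using assms(1) by (auto intro: order_trans)
next
  case (Cons d \<delta>s)
  then obtain s' where "c \<le> T s (d s) s'" "c \<le> u s'" by auto
  then have "c \<le> min (T s (d s) s') (u s')" by simp
  then show ?case using assms(2) order_trans by blast
qed

text \<open>The rank \<open>r\<close> stands for the pass in which the action of a state was last changed.\<close>

definition attained_by_rank ::
  "('s \<Rightarrow> 'a \<Rightarrow> 's \<Rightarrow> 'l::linorder) \<Rightarrow> ('s \<Rightarrow> 'l) \<Rightarrow> ('s \<Rightarrow> 'l) \<Rightarrow> ('s \<Rightarrow> 'a) \<Rightarrow> ('s \<Rightarrow> nat) \<Rightarrow> bool"
  where
  "attained_by_rank T \<mu> u \<delta> r \<longleftrightarrow>
    (\<forall>s. u s \<le> T s (\<delta> s) s \<and> u s \<le> \<mu> s \<or>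
      (\<exists>s'. u s \<le> T s (\<delta> s) s' \<and> (u s < u s' \<or> u s = u s' \<and> r s' < r s)))"

lemma attained_by_rank_attains:
  fixes u :: "'s \<Rightarrow> 'l::{finite,linorder}"
  assumes "attained_by_rank T \<mu> u \<delta> r"
  shows "\<exists>p\<ge>1. attains T \<mu> (u s) s (replicate p \<delta>)"
proof -
  \<comment> \<open>Lexicographic order: a move along \<open>\<delta>\<close> either raises
    \<open>u\<close>, leaving fewer levels above it, or keeps \<open>u\<close> and lowers the
    rank.\<close>
  have "wf (measures [\<lambda>s. card {l. u s < l}, r])" by (rule wf_measures)
  then show ?thesis
  proof (induction s rule: wf_induct_rule)
    case (less s)
    consider "u s \<le> T s (\<delta> s) s" "u s \<le> \<mu> s"
      | s' where "u s \<le> T s (\<delta> s) s'" "u s < u s' \<or> u s = u s' \<and> r s' < r s"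
      using assms by (auto simp: attained_by_rank_def)
    then show ?case
    proof cases
      case 1
      \<comment> \<open>Stopping at \<open>s\<close> is expressed by one transition from
        \<open>s\<close> to itself, as a policy has size at least 1.\<close>
      then show ?thesis by (intro exI[of _ 1]) auto
    next
      case 2
      have "card {l. u s' < l} < card {l. u s < l}" if "u s < u s'"
        using that by (intro psubset_card_mono) auto
      then have "(s', s) \<in> measures [\<lambda>s. card {l. u s < l}, r]" using 2 by auto
      then obtain p where "attains T \<mu> (u s') s' (replicate p \<delta>)" using less by blast
      moreover have "u s \<le> u s'" using 2 by auto
      ultimately have "attains T \<mu> (u s) s (replicate (Suc p) \<delta>)"
        using 2(1) attains_antimono by fastforce
      then show ?thesis by (intro exI[of _ "Suc p"]) auto
    qed
  qed
qed

text \<open>The upper bound is \<open>le_if_attains\<close> with the criterion itself as level; the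
  rank supplies a repetition of \<open>\<delta>\<close> that meets it. The length of that repetition
  may depend on the state.\<close>

lemma max_criterion_eqI:
  fixes T :: "'s::finite \<Rightarrow> 'a \<Rightarrow> 's \<Rightarrow> 'l::{finite,linorder}"
  assumes above: "\<And>s. \<mu> s \<le> u s"
    and closed: "\<And>s a s'. min (T s a s') (u s') \<le> u s"
    and rank: "attained_by_rank T \<mu> u \<delta> r"
  shows "max_criterion T \<mu> s = u s" and "optimal_stationary T \<mu> \<delta>"
proof -
  have policiesI: "\<delta>s \<in> policies \<longleftrightarrow> \<delta>s \<noteq> []" for \<delta>s :: "('s, 'a) policy"
    by (cases \<delta>s) (auto simp: policies_def policies_of_size_def)
  have le: "criterion T \<mu> s \<delta>s \<le> u s" if "\<delta>s \<noteq> []" for s \<delta>s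
  proof (rule le_if_attains[where \<mu> = \<mu>, OF above closed])
    show "attains T \<mu> (criterion T \<mu> s \<delta>s) s \<delta>s"
      by (simp add: le_criterion_iff[OF that, symmetric])
  qed
  have ex: "\<exists>p\<ge>1. criterion T \<mu> s (replicate p \<delta>) = u s" for s
  proof -
    obtain p where p: "p \<ge> 1" "attains T \<mu> (u s) s (replicate p \<delta>)"
      using attained_by_rank_attains[OF rank] by blast
    then have "replicate p \<delta> \<noteq> []" by auto
    with p le have "criterion T \<mu> s (replicate p \<delta>) = u s"
      by (intro order_antisym) (simp_all add: le_criterion_iff)
    with p(1) show ?thesis by blast
  qed
  show eq: "max_criterion T \<mu> s = u s" for s
    unfolding max_criterion_def
  proof (rule Max_eqI)
    show "u s \<in> criterion T \<mu> s ` policies"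
    proof -
      obtain p where "p \<ge> 1" "criterion T \<mu> s (replicate p \<delta>) = u s" using ex by blast
      then show ?thesis by (intro image_eqI[of _ _ "replicate p \<delta>"]) (auto simp: policiesI)
    qed
  qed (auto simp: policiesI le)
  show "optimal_stationary T \<mu> \<delta>"
    unfolding optimal_stationary_def eq using ex by blast
qed

lemma min_le_Max_action_value:
  fixes T :: "'s::finite \<Rightarrow> 'a::finite \<Rightarrow> 's \<Rightarrow> 'l::linorder"
  shows "min (T s a s') (u s') \<le> (MAX a. action_value T u s a)"
proof -
  have "min (T s a s') (u s') \<le> action_value T u s a"
    unfolding action_value_def by (rule Max_ge) auto
  also have "\<dots> \<le> (MAX a. action_value T u s a)" by (rule Max_ge) auto
  finally show ?thesis .
qed

lemma is_arg_max_action_value: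
  fixes T :: "'s::finite \<Rightarrow> 'a::finite \<Rightarrow> 's \<Rightarrow> 'l::linorder"
  assumes "is_arg_max (action_value T u s) (\<lambda>_. True) a"
  shows "\<exists>s'. (MAX a. action_value T u s a) = min (T s a s') (u s')"
proof -
  have "(MAX a. action_value T u s a) = action_value T u s a"
    using assms by (intro Max_eqI) (auto simp: is_arg_max_linorder)
  moreover have "action_value T u s a \<in> range (\<lambda>s'. min (T s a s') (u s'))"
    unfolding action_value_def by (rule Max_in) auto
  ultimately show ?thesis by auto
qed

text \<open>The states updated in this pass get a common rank above all earlier ones, so only ties
  with states not updated need the rank.\<close>

lemma attained_by_rank_vi_step:
  fixes T :: "'s::finite \<Rightarrow> 'a::finite \<Rightarrow> 's \<Rightarrow> 'l::linorder"
  assumes step: "vi_step T (v, u, \<delta>) (u, u', \<delta>')"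
    and incr: "\<And>s. u s \<le> u' s"
    and rank: "attained_by_rank T \<mu> u \<delta> r"
  shows "\<exists>r'. attained_by_rank T \<mu> u' \<delta>' r'"
proof -
  define r' where "r' s = (if u s < u' s then Suc (Max (range r)) else r s)" for s
  have r_le: "r s \<le> Max (range r)" for s by simp
  have new: "\<exists>s'. u' s \<le> T s (\<delta>' s) s' \<and> u' s \<le> u s'" if "u s < u' s" for s
  proof -
    have "is_arg_max (action_value T u s) (\<lambda>_. True) (\<delta>' s)"
      and "u' s = (MAX a. action_value T u s a)"
      using step that by (auto elim: vi_step.cases)
    then show ?thesis using is_arg_max_action_value[of T u s] by (metis min.cobounded1 min.cobounded2)
  qed
  have old: "\<delta>' s = \<delta> s" if "\<not> u s < u' s" for s
    using step that by (auto elim: vi_step.cases)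
  have "attained_by_rank T \<mu> u' \<delta>' r'"
    unfolding attained_by_rank_def
  proof
    fix s
    show "u' s \<le> T s (\<delta>' s) s \<and> u' s \<le> \<mu> s \<or>
      (\<exists>s'. u' s \<le> T s (\<delta>' s) s' \<and> (u' s < u' s' \<or> u' s = u' s' \<and> r' s' < r' s))"
    proof (cases "u s < u' s")
      case True
      then obtain s' where s': "u' s \<le> T s (\<delta>' s) s'" "u' s \<le> u s'" using new by blast
      \<comment> \<open>A tie gives \<open>u' s' = u' s \<le> u s'\<close>, so \<open>s'\<close> was
        not updated and keeps its old, smaller rank.\<close>
      have "r' s' < r' s" if "u' s = u' s'"
        using that True s'(2) le_imp_less_Suc[OF r_le[of s']] by (auto simp: r'_def)
      moreover have "u' s \<le> u' s'" using s'(2) incr order_trans by blast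
      ultimately show ?thesis using s'(1) by (metis order_le_less)
    next
      case False
      then have eq: "u' s = u s" using incr[of s] by auto
      consider "u s \<le> T s (\<delta> s) s" "u s \<le> \<mu> s"
        | s' where "u s \<le> T s (\<delta> s) s'" "u s < u s' \<or> u s = u s' \<and> r s' < r s"
        using rank by (auto simp: attained_by_rank_def)
      then show ?thesis
      proof cases
        case 2
        \<comment> \<open>If \<open>s'\<close> was updated, its value is now strictly above
          \<open>u s\<close>; otherwise both states keep their values and ranks.\<close>
        have "u s < u' s' \<or> u s = u' s' \<and> r' s' < r' s"
          using 2(2) incr[of s'] False by (auto simp: r'_def)
        then show ?thesis using 2(1) by (auto simp: eq old[OF False])
      qed (simp add: eq old[OF False])
    qed
  qed
  then show ?thesis by blast
qed

text \<open>Closure relates \<open>v\<close> to \<open>u\<close>, one pass apart; when the loop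
  exits with \<open>v = u\<close> it becomes the closure used in
  \<open>max_criterion_eqI\<close>.\<close>

lemma vi_reachable_invariant:
  fixes T :: "'s::finite \<Rightarrow> 'a::finite \<Rightarrow> 's \<Rightarrow> 'l::{linorder,order_bot,order_top}"
  assumes stay: "\<And>s. T s abar s = top"
    and "vi_reachable T \<mu> abar (v, u, \<delta>)"
  shows "(\<forall>s. \<mu> s \<le> u s) \<and> (\<forall>s a s'. min (T s a s') (v s') \<le> u s) \<and>
    (\<exists>r. attained_by_rank T \<mu> u \<delta> r)"
proof -
  have "case c of (v, u, \<delta>) \<Rightarrow> (\<forall>s. \<mu> s \<le> u s) \<and> (\<forall>s a s'. min (T s a s') (v s') \<le> u s) \<and>
    (\<exists>r. attained_by_rank T \<mu> u \<delta> r)"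
    if "(vi_step T)\<^sup>*\<^sup>* (vi_init \<mu> abar) c" for c
    using that
  proof (induction rule: rtranclp_induct)
    case base
    \<comment> \<open>Here \<open>v\<close> is \<open>bot\<close>, so closure is trivial, and
      \<open>abar\<close> stays put with \<open>u = \<mu>\<close>, so any rank works.\<close>
    then show ?case
      by (auto simp: vi_init_def attained_by_rank_def stay)
  next
    case (step c c')
    from step.hyps(2) obtain v u \<delta> u' \<delta>' where c: "c = (v, u, \<delta>)" "c' = (u, u', \<delta>')"
      and u': "\<And>s. u' s = (MAX a. action_value T u s a)"
      by (auto elim: vi_step.cases)
    have closed: "min (T s a s') (u s') \<le> u' s" for s a s'
      using min_le_Max_action_value[of T s a s' u] by (simp add: u')
    have incr: "u s \<le> u' s" for s
      using closed[of s abar s] by (simp add: stay)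
    from step.IH obtain r where rank: "attained_by_rank T \<mu> u \<delta> r" and "\<And>s. \<mu> s \<le> u s"
      by (auto simp: c)
    then have "\<mu> s \<le> u' s" for s using incr order_trans by blast
    moreover have "\<exists>r'. attained_by_rank T \<mu> u' \<delta>' r'"
      using attained_by_rank_vi_step[OF step.hyps(2)[unfolded c] incr rank] .
    ultimately show ?case using closed by (simp add: c)
  qed
  then show ?thesis using assms(2) by (fastforce simp: vi_reachable_def)
qed

lemma vi_step_exists:
  fixes T :: "'s::finite \<Rightarrow> 'a::finite \<Rightarrow> 's \<Rightarrow> 'l::linorder"
  assumes "v \<noteq> u"
  shows "\<exists>c. vi_step T (v, u, \<delta>) c"
proof -
  have "\<exists>a. is_arg_max (action_value T u s) (\<lambda>_. True) a" for s
  proof -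
    have "Max (range (action_value T u s)) \<in> range (action_value T u s)" by (rule Max_in) auto
    then obtain a where "Max (range (action_value T u s)) = action_value T u s a" by blast
    then have "action_value T u s b \<le> action_value T u s a" for b
      by (metis Max_ge finite_UNIV finite_imageI rangeI)
    then show ?thesis by (auto simp: is_arg_max_linorder)
  qed
  then obtain best where best: "\<And>s. is_arg_max (action_value T u s) (\<lambda>_. True) (best s)"
    by metis
  define u' where "u' s = (MAX a. action_value T u s a)" for s
  have "vi_step T (v, u, \<delta>) (u, u', \<lambda>s. if u s < u' s then best s else \<delta> s)"
    by (rule vi_step.intros) (use assms best in \<open>simp_all add: u'_def\<close>)
  then show ?thesis ..
qed

text \<open>The iterates would be a strictly increasing sequence in the finite type of functions
  from states to the scale.\<close>

lemma no_infinite_vi_run: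
  fixes T :: "'s::finite \<Rightarrow> 'a::finite \<Rightarrow> 's \<Rightarrow> 'l::{finite,linorder,order_top}"
  assumes stay: "\<And>s. T s abar s = top"
  shows "\<not> (\<forall>i. vi_step T (c i) (c (Suc i)))"
proof
  assume steps: "\<forall>i. vi_step T (c i) (c (Suc i))"
  define f where "f i = fst (snd (c i))" for i
  have "f i < f (Suc i)" for i
  proof -
    obtain v u \<delta> u' \<delta>' where c: "c i = (v, u, \<delta>)" "c (Suc i) = (u, u', \<delta>')"
      and u': "\<And>s. u' s = (MAX a. action_value T u s a)"
      using steps[rule_format, of i] by (auto elim: vi_step.cases)
    \<comment> \<open>Strictness comes from the loop test of the following pass, which compares
      exactly these two iterates.\<close>
    have "u \<noteq> u'"
      using steps[rule_format, of "Suc i"] by (auto simp: c elim: vi_step.cases)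
    moreover have "u s \<le> u' s" for s
      using min_le_Max_action_value[of T s abar s u] by (simp add: u' stay)
    ultimately show ?thesis by (auto simp: f_def c le_fun_def less_le)
  qed
  then have "strict_mono f" by (simp add: strict_mono_Suc_iff)
  then have "inj f" by (rule strict_mono_imp_inj_on)
  then have "finite (UNIV :: nat set)" by (rule finite_imageD[rotated]) simp
  then show False by simp
qed

theorem theorem3:
  fixes T :: "'s::finite \<Rightarrow> 'a::finite \<Rightarrow> 's \<Rightarrow> 'l::{finite,linorder,order_bot,order_top}"
    and \<mu> :: "'s \<Rightarrow> 'l"
    and abar :: 'a
  assumes "pi_mdp T"
    and "\<And>s s'. T s abar s' = (if s' = s then top else bot)"
  shows "vi_terminates T \<mu> abar \<and>
    (\<forall>ustar \<delta>. vi_returns T \<mu> abar ustar \<delta> \<longrightarrow>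
      (\<forall>s. ustar s = max_criterion T \<mu> s) \<and> optimal_stationary T \<mu> \<delta>)"
proof (intro conjI allI impI)
  have stay: "T s abar s = top" for s by (simp add: assms(2))
  show "vi_terminates T \<mu> abar"
    unfolding vi_terminates_def
    using no_infinite_vi_run[of T abar] stay vi_step_exists by blast
  fix ustar \<delta>
  assume "vi_returns T \<mu> abar ustar \<delta>"
  then obtain r where opt: "\<And>s. \<mu> s \<le> ustar s" "\<And>s a s'. min (T s a s') (ustar s') \<le> ustar s"
    "attained_by_rank T \<mu> ustar \<delta> r"
    using vi_reachable_invariant[of T abar \<mu> ustar ustar \<delta>] stay unfolding vi_returns_def by blast
  show "ustar s = max_criterion T \<mu> s" for s by (simp add: max_criterion_eqI[OF opt])
  show "optimal_stationary T \<mu> \<delta>" using max_criterion_eqI[OF opt] by blast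
qed

end
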